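(* Let $n\ge 2$ be even. The partition function for the strip of hexagons with $n$ black nodes on the torus, considering only $z$, is $$\mathcal P_n^{\mathrm{hex}}(z)=z^{n/2}\sum_{p=0}^{n}(-1)^p z^{-p}a_{n,p}=z^{n/2}\,Q_n(-1/z)=\frac{z^{n/2}}{2^n}\left[\left(1-\sqrt{1-\tfrac4z}\right)^n+\left(1+\sqrt{1-\tfrac4z}\right)^n\right],$$ where $a_{n,p}=\frac{n}{n-p}\binom{n-p}{p}$ (read as $0$ for $p>n/2$) and $Q_n$ is the monomer-dimer partition function of the cycle with $n$ nodes.
   Context: Strip of squares. For even $n\ge2$, the strip of squares $\mathcal G_{2,n}$ on the torus is the multigraph with $2n$ nodes $(r,j)$, $r\in\mathbb Z/2$ (row; $r=0$ bottom, $r=1$ top), $j\in\mathbb Z/n$ (column). Node $(r,j)$ is black if $r+j$ is even and white otherwise, so there are $n$ black nodes. There are $4n$ distinct edges (parallel edges count as different): horizontal edges $h_{r,j}$ joining $(r,j)$ and $(r,j+1)$, and vertical edges $v_{r,j}$ joining $(r,j)$ and $(r+1,j)$, where $v_{r,j}$ is thought of as going upwards from $(r,j)$; thus $v_{0,j}$ is internal and $v_{1,j}$ crosses the cycle $z$ of the torus. Strip of hexagons. It is obtained from $\mathcal G_{2,n}$ by deleting half of the vertical edges, namely all $v_{r,j}$ with $(r,j)$ white; so each black node keeps its left, right and up edges. Weights. A perfect matching is a set of edges touching each node exactly once. Edges are directed from black to white. The $z$-weight $n_z$ of a matching $M$ is the sum over edges $v_{1,j}\in M$ of $+1$ if $(1,j)$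 is black and $-1$ if $(1,j)$ is white. The $w$-weight $n_w$ of $M$ is the sum over edges $h_{r,n-1}\in M$ (those crossing the cycle $w$) of $+1$ if $(r,n-1)$ is black and $-1$ if $(r,n-1)$ is white. Partition functions. The full partition function (Newton polynomial) is $\sum_{n_z,n_w}N_{n_z,n_w}(-1)^{n_z+n_w+n_zn_w}z^{n_z}w^{n_w}$, where $N_{n_z,n_w}$ is the number of perfect matchings of weight $(n_z,n_w)$. The partition function considering only $z$, $\mathcal P_n^{\mathrm{hex}}(z)$, is its $w^0$ part, for the strip of hexagons. Monomer-dimer system. $Q_n(q)=\sum_{p}a_{n,p}q^p$, where $a_{n,p}$ is the number of (not necessarily perfect) matchings with exactly $p$ edges in the cycle with $n$ nodes and $n$ edges (for $n=2$: two nodes joined by two distinct parallel edges); $a_{n,p}$ is also the number of perfect matchings of the strip of hexagons with $z$-weight $n/2-p$ (and $n_w=0$).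
   Formalization: The first equality carries an extra overall sign (-1)^{n/2}: with the stated sign rule it fails for n ≡ 2 mod 4 (for n=2 the partition function is 2−z, not z−2). For n divisible by 4 it is unchanged; the rest of the chain and the formula for a_{n,p} are as stated, for all complex z ≠ 0. *)

theory Defs
  imports Complex_Main
begin

text \<open>Finite multigraphs are given by an edge set together with a map \<open>ends\<close> sending each
  edge to its set of endpoints, so parallel edges are distinct edges.\<close>

definition is_matching :: "('e \<Rightarrow> 'v set) \<Rightarrow> 'e set \<Rightarrow> 'e set \<Rightarrow> bool" where
  "is_matching ends E M \<longleftrightarrow>
     M \<subseteq> E \<and> (\<forall>e\<in>M. \<forall>f\<in>M. e \<noteq> f \<longrightarrow> ends e \<inter> ends f = {})"

definition is_perfect_matching :: "('e \<Rightarrow> 'v set) \<Rightarrow> 'v set \<Rightarrow> 'e set \<Rightarrow> 'e set \<Rightarrow> bool" where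
  "is_perfect_matching ends V E M \<longleftrightarrow> M \<subseteq> E \<and> (\<forall>x\<in>V. \<exists>!e. e \<in> M \<and> x \<in> ends e)"

text \<open>Rows in \<open>\<int>/2\<close> and columns in \<open>\<int>/n\<close> are represented by their residues in \<open>{..<2}\<close> and
  \<open>{..<n}\<close>.  \<open>Vert r j\<close> goes upwards from \<open>(r, j)\<close>, so \<open>Vert 1 j\<close> crosses the cycle \<open>z\<close>;
  \<open>Horiz r (n - 1)\<close> crosses the cycle \<open>w\<close>.\<close>

type_synonym node = "nat \<times> nat"

datatype edge = Horiz nat nat | Vert nat nat

definition nodes :: "nat \<Rightarrow> node set" where
  "nodes n = {..<2} \<times> {..<n}"

definition black :: "node \<Rightarrow> bool" where
  "black x \<longleftrightarrow> even (fst x + snd x)"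

fun strip_ends :: "nat \<Rightarrow> edge \<Rightarrow> node set" where
  "strip_ends n (Horiz r j) = {(r, j), (r, (j + 1) mod n)}"
| "strip_ends n (Vert r j) = {(r, j), ((r + 1) mod 2, j)}"

definition square_edges :: "nat \<Rightarrow> edge set" where
  "square_edges n = {Horiz r j |r j. r < 2 \<and> j < n} \<union> {Vert r j |r j. r < 2 \<and> j < n}"

definition hex_edges :: "nat \<Rightarrow> edge set" where
  "hex_edges n = square_edges n - {Vert r j |r j. \<not> black (r, j)}"

definition colour_sign :: "node \<Rightarrow> int" where
  "colour_sign x = (if black x then 1 else - 1)"

definition z_weight :: "edge set \<Rightarrow> int" where
  "z_weight M = (\<Sum>j | Vert 1 j \<in> M. colour_sign (1, j))"

definition w_weight :: "nat \<Rightarrow> edge set \<Rightarrow> int" where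
  "w_weight n M = (\<Sum>r | Horiz r (n - 1) \<in> M. colour_sign (r, n - 1))"

definition num_perfect :: "edge set \<Rightarrow> nat \<Rightarrow> int \<Rightarrow> int \<Rightarrow> nat" where
  "num_perfect E n k l =
     card {M. is_perfect_matching (strip_ends n) (nodes n) E M \<and> z_weight M = k \<and> w_weight n M = l}"

text \<open>The Newton polynomial is a Laurent polynomial in \<open>z\<close> and \<open>w\<close>; \<open>newton_coeff E n k l\<close> is its
  coefficient of \<open>z\<^sup>k w\<^sup>l\<close>.  Only finitely many coefficients are nonzero, so the sum below, which
  evaluates the \<open>w\<^sup>0\<close> part at \<open>z\<close>, is finite.  With this sign rule the leading coefficient of
  \<open>P_hex n\<close> is \<open>(-1)\<^sup>n\<^sup>/\<^sup>2\<close> (for \<open>n = 2\<close> the polynomial is \<open>2 - z\<close>), so its expression in terms of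
  \<open>z\<^sup>n\<^sup>/\<^sup>2 Q\<^sub>n(-1/z)\<close>, which is monic, carries the overall sign \<open>(-1)\<^sup>n\<^sup>/\<^sup>2\<close>.\<close>

definition newton_coeff :: "edge set \<Rightarrow> nat \<Rightarrow> int \<Rightarrow> int \<Rightarrow> complex" where
  "newton_coeff E n k l = (- 1) powi (k + l + k * l) * of_nat (num_perfect E n k l)"

definition partition_z :: "edge set \<Rightarrow> nat \<Rightarrow> complex \<Rightarrow> complex" where
  "partition_z E n z = (\<Sum>k | newton_coeff E n k 0 \<noteq> 0. newton_coeff E n k 0 * z powi k)"

abbreviation P_hex :: "nat \<Rightarrow> complex \<Rightarrow> complex" where
  "P_hex n \<equiv> partition_z (hex_edges n) n"

text \<open>Edge \<open>j < n\<close> of the cycle joins the nodes \<open>j\<close> and \<open>j + 1\<close> modulo \<open>n\<close>; for \<open>n = 2\<close> this gives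
  two parallel edges.\<close>

definition cycle_ends :: "nat \<Rightarrow> nat \<Rightarrow> nat set" where
  "cycle_ends n j = {j, (j + 1) mod n}"

definition cycle_matchings :: "nat \<Rightarrow> nat \<Rightarrow> nat" where
  "cycle_matchings n p = card {M. is_matching (cycle_ends n) {..<n} M \<and> card M = p}"

definition monomer_dimer :: "nat \<Rightarrow> complex \<Rightarrow> complex" where
  "monomer_dimer n q = (\<Sum>p = 0..n. of_nat (cycle_matchings n p) * q ^ p)"

end

theory Submission
  imports Defs
begin

text \<open>
  In the strip of hexagons every column carries exactly one vertical edge, so in a perfect matching
  the two nodes of a column are both matched vertically or both horizontally.  Hence the difference
  between the indicators of the two horizontal edges leaving column \<open>j\<close> changes sign
  from column to column, and \<open>n\<^sub>w = 0\<close> forces it to vanish: both rows carry the same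
  matching of the \<open>n\<close>-cycle, and the uncovered columns are matched vertically.  Every edge of the
  cycle covers exactly one odd column, and vertical edges cross \<open>z\<close> only in odd columns, which gives
  \<open>n\<^sub>z = n/2 - p\<close>.  Splitting the cycle matchings according to the last edge reduces both
  their number and their generating function to the two-term recurrence for paths.
\<close>

section \<open>Matchings of paths and cycles\<close>

text \<open>Matchings of the path with \<open>m\<close> edges and \<open>m + 1\<close> nodes: edge
  \<open>i\<close> joins nodes \<open>i\<close> and \<open>i + 1\<close>, so distinct edges meet
  exactly when their labels are consecutive.\<close>

definition path_sets :: "nat \<Rightarrow> nat set set" where
  "path_sets m = {S. S \<subseteq> {..<m} \<and> (\<forall>i\<in>S. Suc i \<notin> S)}"

definition cycle_sets :: "nat \<Rightarrow> nat set set" where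
  "cycle_sets n = {S. is_matching (cycle_ends n) {..<n} S}"

lemma finite_path_sets [simp]: "finite (path_sets m)"
  by (rule finite_subset[of _ "Pow {..<m}"]) (auto simp: path_sets_def)

lemma finite_path_setsD: "S \<in> path_sets m \<Longrightarrow> finite S"
  by (auto simp: path_sets_def intro: finite_subset)

lemma path_sets_0: "path_sets 0 = {{}}"
  by (auto simp: path_sets_def)

lemma path_sets_1: "path_sets (Suc 0) = {{}, {0}}"
  by (auto simp: path_sets_def)

text \<open>If the last edge \<open>Suc m\<close> is used, edge \<open>m\<close> is blocked and the
  rest lies among the first \<open>m\<close> edges.\<close>

lemma path_sets_Suc_Suc:
  "path_sets (Suc (Suc m)) = path_sets (Suc m) \<union> insert (Suc m) ` path_sets m"
proof (intro subset_antisym subsetI)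
  fix S assume S: "S \<in> path_sets (Suc (Suc m))"
  show "S \<in> path_sets (Suc m) \<union> insert (Suc m) ` path_sets m"
  proof (cases "Suc m \<in> S")
    case True
    have "m \<notin> S" using S True by (auto simp: path_sets_def)
    then have "S - {Suc m} \<in> path_sets m"
      using S by (auto simp: path_sets_def less_Suc_eq)
    then show ?thesis using True by (metis UnI2 imageI insert_Diff)
  next
    case False
    then show ?thesis using S by (auto simp: path_sets_def less_Suc_eq)
  qed
qed (auto simp: path_sets_def less_Suc_eq)

text \<open>An arbitrary \<open>g\<close> serves both the count (indicator of a size) and the
  generating function (powers of \<open>q\<close>).\<close>

lemma sum_path_sets_Suc_Suc:
  fixes g :: "nat \<Rightarrow> 'a::comm_monoid_add"
  shows "(\<Sum>S\<in>path_sets (Suc (Suc m)). g (card S)) =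
    (\<Sum>S\<in>path_sets (Suc m). g (card S)) + (\<Sum>S\<in>path_sets m. g (Suc (card S)))"
proof -
  have new: "Suc m \<notin> S" if "S \<in> path_sets m" for S
    using that by (auto simp: path_sets_def)
  have inj: "inj_on (insert (Suc m)) (path_sets m)"
    using new by (intro inj_onI) (metis insert_ident)
  have "(\<Sum>S\<in>insert (Suc m) ` path_sets m. g (card S)) = (\<Sum>S\<in>path_sets m. g (Suc (card S)))"
    by (simp add: sum.reindex[OF inj] new finite_path_setsD)
  moreover have "path_sets (Suc m) \<inter> insert (Suc m) ` path_sets m = {}"
    by (auto simp: path_sets_def)
  ultimately show ?thesis
    by (simp add: path_sets_Suc_Suc sum.union_disjoint)
qed

text \<open>The path recurrence turns into Pascal's rule. Counting by a sum of indicators lets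
  \<open>sum_path_sets_Suc_Suc\<close> apply directly.\<close>

lemma card_path_sets: "(\<Sum>S\<in>path_sets m. if card S = p then 1 else 0) = (m + 1 - p) choose p"
proof (induction m arbitrary: p rule: induct_nat_012)
  case 0
  then show ?case by (cases p) (auto simp: path_sets_0)
next
  case 1
  show ?case by (cases p; cases "p - 1") (auto simp: path_sets_1)
next
  case (ge2 m)
  note rec = sum_path_sets_Suc_Suc[where g = "\<lambda>c. if c = p then 1 else (0::nat)" and m = m]
  show ?case
  proof (cases p)
    case 0
    then show ?thesis using ge2(2)[of 0] rec by simp
  next
    case (Suc q)
    have "(\<Sum>S\<in>path_sets (Suc (Suc m)). if card S = p then 1 else 0) =
        (Suc m - q choose Suc q) + (Suc m - q choose q)"
      using ge2(1)[of q] ge2(2)[of p] Suc rec by simp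
    \<comment> \<open>Pascal's rule for \<open>q <= Suc m\<close>; beyond that the truncated
      differences are \<open>0\<close> and, as \<open>q > 0\<close>, all binomials vanish.\<close>
    then show ?thesis using Suc
      by (cases "q \<le> Suc m") (auto simp: Suc_diff_le)
  qed
qed

section \<open>Matchings of the cycle and their reduction to paths\<close>

text \<open>For \<open>n >= 2\<close> the successor modulo \<open>n\<close> is injective without
  fixed points, so two distinct edges can only meet where one is the successor of the other.\<close>

lemma mem_cycle_sets:
  assumes "n \<ge> 2"
  shows "S \<in> cycle_sets n \<longleftrightarrow> S \<subseteq> {..<n} \<and> (\<forall>i\<in>S. Suc i mod n \<notin> S)"
proof -
  have shift: "Suc i mod n \<noteq> i" if "i < n" for i
    using assms that by (auto simp: mod_Suc)
  have inj: "i = j" if "i < n" "j < n" "Suc i mod n = Suc j mod n" for i j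
    using that by (auto simp: mod_Suc split: if_splits)
  show ?thesis
  proof
    assume "S \<in> cycle_sets n"
    then have "S \<subseteq> {..<n}"
      and "\<forall>i\<in>S. \<forall>j\<in>S. i \<noteq> j \<longrightarrow> cycle_ends n i \<inter> cycle_ends n j = {}"
      by (auto simp: cycle_sets_def is_matching_def)
    then show "S \<subseteq> {..<n} \<and> (\<forall>i\<in>S. Suc i mod n \<notin> S)"
      using shift by (fastforce simp: cycle_ends_def)
  next
    assume S: "S \<subseteq> {..<n} \<and> (\<forall>i\<in>S. Suc i mod n \<notin> S)"
    show "S \<in> cycle_sets n"
      unfolding cycle_sets_def is_matching_def cycle_ends_def mem_Collect_eq
    proof (intro conjI ballI impI)
      show "S \<subseteq> {..<n}" using S by blast
      fix i j assume ij: "i \<in> S" "j \<in> S" "i \<noteq> j"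
      then have "Suc i mod n \<noteq> j" "Suc j mod n \<noteq> i" "Suc i mod n \<noteq> Suc j mod n"
        using S inj[of i j] by auto
      then show "{i, (i + 1) mod n} \<inter> {j, (j + 1) mod n} = {}" using ij by auto
    qed
  qed
qed

lemma finite_cycle_sets [simp]: "finite (cycle_sets n)"
  by (rule finite_subset[of _ "Pow {..<n}"]) (auto simp: cycle_sets_def is_matching_def)

lemma cycle_setsD:
  assumes "S \<in> cycle_sets n"
  shows "S \<subseteq> {..<n}" "finite S" "card S \<le> n"
proof -
  show "S \<subseteq> {..<n}" using assms by (auto simp: cycle_sets_def is_matching_def)
  then show "finite S" "card S \<le> n"
    by (auto intro: finite_subset dest: card_mono[rotated])
qed

text \<open>For \<open>n = 2\<close> the truncated \<open>n - 3\<close> is \<open>0\<close>, which is still correct because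
  \<open>path_sets 0\<close> contains the empty set only.\<close>

lemma cycle_sets_split:
  assumes "n \<ge> 2"
  shows "cycle_sets n =
    path_sets (n - 1) \<union> (\<lambda>S. insert (n - 1) (Suc ` S)) ` path_sets (n - 3)"
proof (intro subset_antisym subsetI)
  fix S assume "S \<in> cycle_sets n"
  then have S: "S \<subseteq> {..<n}" "\<And>i. i \<in> S \<Longrightarrow> Suc i mod n \<notin> S"
    using mem_cycle_sets[OF assms] by auto
  have suc: "Suc i \<notin> S" if "i \<in> S" for i
    using S(1) S(2)[OF that] by (cases "Suc i < n") auto
  show "S \<in> path_sets (n - 1) \<union> (\<lambda>S. insert (n - 1) (Suc ` S)) ` path_sets (n - 3)"
  proof (cases "n - 1 \<in> S")
    case False
    have "S \<subseteq> {..<n - 1}"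
    proof
      fix i assume "i \<in> S"
      then have "i < n" "i \<noteq> n - 1" using S(1) False by auto
      then show "i \<in> {..<n - 1}" by auto
    qed
    then show ?thesis using suc by (auto simp: path_sets_def)
  next
    case True
    have no0: "0 \<notin> S" using S(2)[OF True] assms by simp
    \<comment> \<open>The chosen edge \<open>n - 1\<close> blocks its neighbours \<open>0\<close>
      and \<open>n - 2\<close>. The edges \<open>1\<close> to \<open>n - 3\<close> that remain form
      a path, which \<open>T\<close> relabels from \<open>0\<close>.\<close>
    define T where "T = {i. Suc i \<in> S \<and> Suc i \<noteq> n - 1}"
    have "T \<subseteq> {..<n - 3}"
    proof
      fix i assume "i \<in> T"
      then have i: "Suc i \<in> S" "Suc i \<noteq> n - 1" "Suc i < n" using S(1) by (auto simp: T_def)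
      then have "Suc (Suc i) \<noteq> n - 1" using suc[OF i(1)] True by auto
      then show "i \<in> {..<n - 3}" using i by auto
    qed
    then have "T \<in> path_sets (n - 3)" using suc by (auto simp: path_sets_def T_def)
    moreover have "S = insert (n - 1) (Suc ` T)"
    proof (intro subset_antisym subsetI)
      fix i assume "i \<in> S"
      then show "i \<in> insert (n - 1) (Suc ` T)" using no0 by (cases i) (auto simp: T_def)
    qed (use True in \<open>auto simp: T_def\<close>)
    ultimately show ?thesis by blast
  qed
next
  fix S assume "S \<in> path_sets (n - 1) \<union> (\<lambda>S. insert (n - 1) (Suc ` S)) ` path_sets (n - 3)"
  then show "S \<in> cycle_sets n"
  proof
    assume S: "S \<in> path_sets (n - 1)"
    then have "i < n - 1" if "i \<in> S" for i using that by (auto simp: path_sets_def)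
    then show ?thesis using S
      by (force simp: mem_cycle_sets[OF assms] path_sets_def)
  next
    assume "S \<in> (\<lambda>S. insert (n - 1) (Suc ` S)) ` path_sets (n - 3)"
    then obtain T where T: "T \<in> path_sets (n - 3)" "S = insert (n - 1) (Suc ` T)" by blast
    have lt: "i < n - 3" if "i \<in> T" for i using T(1) that by (auto simp: path_sets_def)
    have "Suc i mod n \<notin> S" if i: "i \<in> S" for i
    proof (cases "i = n - 1")
      case True
      then show ?thesis using assms T(2) by auto
    next
      case False
      then obtain j where j: "j \<in> T" "i = Suc j" using T(2) i by auto
      have "Suc j \<notin> T" using T(1) j by (auto simp: path_sets_def)
      then show ?thesis using lt[OF j(1)] j T(2) by auto
    qed
    moreover have "S \<subseteq> {..<n}" using lt T(2) assms by force
    ultimately show ?thesis using mem_cycle_sets[OF assms] by blast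
  qed
qed

lemma sum_cycle_sets:
  fixes g :: "nat \<Rightarrow> 'a::comm_monoid_add"
  assumes "n \<ge> 2"
  shows "(\<Sum>S\<in>cycle_sets n. g (card S)) =
    (\<Sum>S\<in>path_sets (n - 1). g (card S)) + (\<Sum>S\<in>path_sets (n - 3). g (Suc (card S)))"
proof -
  let ?f = "\<lambda>S. insert (n - 1) (Suc ` S)"
  have new: "n - 1 \<notin> Suc ` S" if "S \<in> path_sets (n - 3)" for S
    using that by (auto simp: path_sets_def)
  have inj: "inj_on ?f (path_sets (n - 3))"
  proof (rule inj_onI)
    fix S T assume "S \<in> path_sets (n - 3)" "T \<in> path_sets (n - 3)" "?f S = ?f T"
    then have "Suc ` S = Suc ` T" using new by (metis insert_ident)
    then show "S = T" by (simp add: inj_image_eq_iff)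
  qed
  have card: "card (?f S) = Suc (card S)" if "S \<in> path_sets (n - 3)" for S
    using new[OF that] finite_path_setsD[OF that] by (simp add: card_image)
  have "path_sets (n - 1) \<inter> ?f ` path_sets (n - 3) = {}"
    by (auto simp: path_sets_def)
  then have "(\<Sum>S\<in>cycle_sets n. g (card S)) =
      (\<Sum>S\<in>path_sets (n - 1). g (card S)) + (\<Sum>S\<in>?f ` path_sets (n - 3). g (card S))"
    by (simp add: cycle_sets_split[OF assms] sum.union_disjoint)
  moreover have "(\<Sum>S\<in>?f ` path_sets (n - 3). g (card S)) =
      (\<Sum>S\<in>path_sets (n - 3). g (Suc (card S)))"
    unfolding sum.reindex[OF inj] by (rule sum.cong) (simp_all only: card o_def)
  ultimately show ?thesis by simp
qed

section \<open>The numbers of cycle matchings and their generating function\<close>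

lemma cycle_matchings_eq: "cycle_matchings n p = card {S \<in> cycle_sets n. card S = p}"
  by (simp add: cycle_matchings_def cycle_sets_def)

text \<open>For \<open>p > 0\<close>, splitting on the last edge gives two binomials; the absorption
  identity makes the second a multiple of the first.\<close>

lemma cycle_matchings_formula:
  assumes "n \<ge> 2"
  shows "real (cycle_matchings n p) =
    (if 2 * p \<le> n then real n / real (n - p) * real ((n - p) choose p) else 0)"
proof -
  have "cycle_matchings n p = (\<Sum>S\<in>cycle_sets n. if card S = p then 1 else 0)"
    by (simp add: cycle_matchings_eq flip: sum.inter_filter)
  also have "\<dots> = (n - p choose p) + (\<Sum>S\<in>path_sets (n - 3). if Suc (card S) = p then 1 else 0)"
    using assms card_path_sets[of p "n - 1"]
    by (simp add: sum_cycle_sets[where g = "\<lambda>c. if c = p then 1 else 0"])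
  finally have eq: "cycle_matchings n p =
    (n - p choose p) + (\<Sum>S\<in>path_sets (n - 3). if Suc (card S) = p then 1 else 0)" .
  show ?thesis
  proof (cases p)
    case 0
    then show ?thesis using eq assms by simp
  next
    case (Suc q)
    then have eq': "cycle_matchings n p = (n - p choose p) + (n - 3 + 1 - q choose q)"
      using eq card_path_sets[of q "n - 3"] by simp
    show ?thesis
    proof (cases "2 * p \<le> n")
      case False
      then have "n - p < p" "n - 3 + 1 - q < q \<or> n = 2 \<and> q = 1" using Suc assms by auto
      then show ?thesis using eq' False Suc by (auto simp: binomial_eq_0)
    next
      case True
      \<comment> \<open>For \<open>n = 2\<close> truncation makes \<open>n - 3 + 1\<close> equal to
        \<open>1\<close> instead of \<open>n - 2\<close>; there \<open>p = 1\<close> and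
        \<open>q = 0\<close>, and both sides are \<open>1\<close>.\<close>
      have "n - 3 + 1 - q choose q = (n - p - 1 choose q)"
        using True Suc by (cases "n = 2") auto
      moreover have "real p * real (n - p choose p) = real (n - p) * real (n - p - 1 choose q)"
      proof -
        have "Suc q * (Suc (n - p - 1) choose Suc q) = Suc (n - p - 1) * (n - p - 1 choose q)"
          by (rule Suc_times_binomial)
        moreover have "Suc (n - p - 1) = n - p" using True assms by auto
        ultimately have "p * (n - p choose p) = (n - p) * (n - p - 1 choose q)"
          using Suc by metis
        then show ?thesis by (metis of_nat_mult)
      qed
      moreover have "real (n - p) > 0" "real n = real (n - p) + real p" using True assms by auto
      \<comment> \<open>Here \<open>a\<close> and \<open>c\<close> are the two binomials,
        \<open>d = n - p\<close>, \<open>P = p\<close> and \<open>N = n\<close>.\<close>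
      moreover have "a + c = N / d * a" if "P * a = d * c" "d > 0" "N = d + P" for a c d N P :: real
        using that by (simp add: field_simps)
      ultimately show ?thesis using True eq' by (metis of_nat_add)
    qed
  qed
qed

lemma monomer_dimer_eq_sum: "monomer_dimer n q = (\<Sum>S\<in>cycle_sets n. q ^ card S)"
proof -
  have "(\<Sum>S\<in>cycle_sets n. q ^ card S) =
      (\<Sum>p = 0..n. \<Sum>S | S \<in> cycle_sets n \<and> card S = p. q ^ card S)"
    by (rule sum.group[symmetric]) (auto dest: cycle_setsD)
  also have "\<dots> = monomer_dimer n q"
    by (simp add: monomer_dimer_def cycle_matchings_eq)
  finally show ?thesis by simp
qed

text \<open>By the hypotheses \<open>x\<close> and \<open>y\<close> are roots of
  \<open>t^2 = t + q\<close>, the characteristic equation of the path recurrence, so their power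
  sums obey the same recurrence; the initial values agree.\<close>

lemma monomer_dimer_power_sum:
  fixes x y :: complex
  assumes n: "n \<ge> 2" and xy: "x + y = 1" and q: "q = - (x * y)"
  shows "monomer_dimer n q = x ^ n + y ^ n"
proof -
  define F where "F m = (\<Sum>S\<in>path_sets m. q ^ card S)" for m
  have F0: "F 0 = 1" and F1: "F (Suc 0) = 1 + q" by (simp_all add: F_def path_sets_0 path_sets_1)
  have FS: "F (Suc (Suc m)) = F (Suc m) + q * F m" for m
    unfolding F_def by (simp add: sum_path_sets_Suc_Suc[where g = "\<lambda>c. q ^ c"] sum_distrib_left)
  have y: "y = 1 - x" using xy by (simp add: algebra_simps)
  have rec: "u ^ Suc (Suc k) = u ^ Suc k + q * u ^ k" if "u = x \<or> u = y" for u k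
  proof -
    have "x ^ 2 = x + q" "y ^ 2 = y + q" by (simp_all add: q y power2_eq_square algebra_simps)
    then have "u ^ 2 = u + q" using that by blast
    then have "u ^ k * u ^ 2 = u ^ k * (u + q)" by simp
    then show ?thesis by (simp add: power2_eq_square algebra_simps)
  qed
  \<comment> \<open>The cycle splitting for \<open>n = m + 3\<close>. The case \<open>n = 2\<close>,
    where \<open>n - 3\<close> truncates, is checked separately below.\<close>
  have base: "F (m + 2) + q * F m = x ^ (m + 3) + y ^ (m + 3)" for m
  proof (induction m rule: induct_nat_012)
    case 0
    show ?case by (simp add: numeral_3_eq_3 numeral_2_eq_2 FS F0 F1 q y algebra_simps)
  next
    case 1
    show ?case by (simp add: numeral_3_eq_3 numeral_2_eq_2 FS F0 F1 q y algebra_simps)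
  next
    case (ge2 m)
    have "F (Suc (Suc m) + 2) + q * F (Suc (Suc m)) =
        (F (Suc m + 2) + q * F (Suc m)) + q * (F (m + 2) + q * F m)"
      by (simp add: FS algebra_simps)
    also have "\<dots> = x ^ (Suc (Suc m) + 3) + y ^ (Suc (Suc m) + 3)"
      unfolding ge2 using rec[of x "m + 3"] rec[of y "m + 3"] by (simp add: algebra_simps)
    finally show ?case .
  qed
  have "monomer_dimer n q = F (n - 1) + q * F (n - 3)"
    unfolding monomer_dimer_eq_sum F_def
    using n by (simp add: sum_cycle_sets[where g = "\<lambda>c. q ^ c"] sum_distrib_left)
  also have "\<dots> = x ^ n + y ^ n"
  proof (cases "n = 2")
    case True
    then show ?thesis by (simp add: F0 F1 q y power2_eq_square algebra_simps)
  next
    case False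
    then have "n - 1 = (n - 3) + 2" "(n - 3) + 3 = n" using n by auto
    then show ?thesis using base[of "n - 3"] by metis
  qed
  finally show ?thesis .
qed

section \<open>Perfect matchings of the strip of hexagons\<close>

text \<open>The inverse of the successor modulo \<open>n\<close>; it labels the horizontal edge
  entering column \<open>j\<close> from the left.\<close>

definition cyclic_pred :: "nat \<Rightarrow> nat \<Rightarrow> nat" where
  "cyclic_pred n j = (if j = 0 then n - 1 else j - 1)"

lemma cyclic_pred_less: "j < n \<Longrightarrow> cyclic_pred n j < n"
  by (auto simp: cyclic_pred_def)

lemma cyclic_pred_neq: "n \<ge> 2 \<Longrightarrow> cyclic_pred n j \<noteq> j"
  by (auto simp: cyclic_pred_def)

lemma Suc_mod_eq_iff:
  assumes "i < n" "j < n"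
  shows "Suc i mod n = j \<longleftrightarrow> i = cyclic_pred n j"
  using assms by (auto simp: cyclic_pred_def mod_Suc split: if_splits)

text \<open>The black node of column \<open>j\<close> lies in row \<open>j mod 2\<close>, and only
  its upward edge survives.\<close>

lemma hex_edges_eq:
  "hex_edges n = {Horiz r j |r j. r < 2 \<and> j < n} \<union> {Vert (j mod 2) j |j. j < n}"
proof -
  have col: "black (r, j) \<longleftrightarrow> r = j mod 2" if "r < 2" for r j
    using that unfolding black_def fst_conv snd_conv by presburger
  have "e \<in> hex_edges n \<longleftrightarrow>
      e \<in> {Horiz r j |r j. r < 2 \<and> j < n} \<union> {Vert (j mod 2) j |j. j < n}" for e
    by (cases e) (auto simp: hex_edges_def square_edges_def col)
  then show ?thesis by blast
qed

text \<open>The only vertical edge of a column ends in both of its rows, so the third edge in this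
  list does not depend on \<open>r\<close>.\<close>

lemma hex_edges_incident:
  assumes "r < 2" "j < n"
  shows "{e \<in> hex_edges n. (r, j) \<in> strip_ends n e} =
    {Horiz r j, Horiz r (cyclic_pred n j), Vert (j mod 2) j}"
proof -
  have horiz: "(r, j) \<in> strip_ends n (Horiz s i) \<longleftrightarrow> s = r \<and> (i = j \<or> i = cyclic_pred n j)"
    if "i < n" for s i
    using Suc_mod_eq_iff[OF that assms(2)] by auto
  have "r = i mod 2 \<or> r = (i mod 2 + 1) mod 2" for i using assms(1) by presburger
  then have vert: "(r, j) \<in> strip_ends n (Vert (i mod 2) i) \<longleftrightarrow> i = j" for i
    by auto
  have "e \<in> {e \<in> hex_edges n. (r, j) \<in> strip_ends n e} \<longleftrightarrow>
      e \<in> {Horiz r j, Horiz r (cyclic_pred n j), Vert (j mod 2) j}" for e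
  proof (cases e)
    case (Horiz s i)
    then show ?thesis using assms cyclic_pred_less[OF assms(2)] horiz[of i s]
      by (auto simp: hex_edges_eq simp del: strip_ends.simps)
  next
    case (Vert s i)
    then show ?thesis using assms vert[of i]
      by (auto simp: hex_edges_eq simp del: strip_ends.simps)
  qed
  then show ?thesis by blast
qed

text \<open>Says that exactly one edge at \<open>(r, j)\<close> is chosen, with the case split on
  the vertical edge because both rows share it.\<close>

definition column_matched :: "nat \<Rightarrow> edge set \<Rightarrow> nat \<Rightarrow> nat \<Rightarrow> bool" where
  "column_matched n M r j \<longleftrightarrow>
    (if Vert (j mod 2) j \<in> M then Horiz r j \<notin> M \<and> Horiz r (cyclic_pred n j) \<notin> M
     else Horiz r j \<in> M \<longleftrightarrow> Horiz r (cyclic_pred n j) \<notin> M)"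

lemma perfect_matching_hex_iff:
  assumes "n \<ge> 2"
  shows "is_perfect_matching (strip_ends n) (nodes n) (hex_edges n) M \<longleftrightarrow>
    M \<subseteq> hex_edges n \<and> (\<forall>r<2. \<forall>j<n. column_matched n M r j)"
proof -
  have "(\<exists>!e. e \<in> M \<and> (r, j) \<in> strip_ends n e) \<longleftrightarrow> column_matched n M r j"
    if M: "M \<subseteq> hex_edges n" and rj: "r < 2" "j < n" for r j
  proof -
    have "e \<in> M \<and> (r, j) \<in> strip_ends n e \<longleftrightarrow>
        e \<in> M \<and> e \<in> {Horiz r j, Horiz r (cyclic_pred n j), Vert (j mod 2) j}" for e
      using M hex_edges_incident[OF rj] by blast
    then have "(\<exists>!e. e \<in> M \<and> (r, j) \<in> strip_ends n e) \<longleftrightarrow>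
        (\<exists>!e. e \<in> M \<and> e \<in> {Horiz r j, Horiz r (cyclic_pred n j), Vert (j mod 2) j})"
      by simp
    also have "\<dots> \<longleftrightarrow> column_matched n M r j"
      \<comment> \<open>For \<open>n >= 2\<close> the edges to the left and right are distinct, even
        when they are parallel.\<close>
      unfolding column_matched_def using cyclic_pred_neq[OF assms, of j] by (auto simp: Ex1_def)
    finally show ?thesis .
  qed
  note column = this
  have nodes: "(\<forall>x\<in>nodes n. P x) \<longleftrightarrow> (\<forall>r<2. \<forall>j<n. P (r, j))" for P
    by (auto simp: nodes_def)
  show ?thesis
    unfolding is_perfect_matching_def nodes by (simp add: column cong: conj_cong)
qed

section \<open>Perfect matchings from cycle matchings\<close>

text \<open>Columns of the strip are nodes of the cycle, and the matching \<open>S\<close> covers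
  column \<open>j\<close> exactly when it contains edge \<open>j\<close> or
  \<open>cyclic_pred n j\<close>.\<close>

definition doubled :: "nat \<Rightarrow> nat set \<Rightarrow> edge set" where
  "doubled n S = {Horiz r j |r j. r < 2 \<and> j \<in> S} \<union>
    {Vert (j mod 2) j |j. j < n \<and> j \<notin> S \<and> cyclic_pred n j \<notin> S}"

lemma Horiz_mem_doubled: "Horiz r j \<in> doubled n S \<longleftrightarrow> r < 2 \<and> j \<in> S"
  by (auto simp: doubled_def)

lemma Vert_mem_doubled:
  "Vert r j \<in> doubled n S \<longleftrightarrow> r = j mod 2 \<and> j < n \<and> j \<notin> S \<and> cyclic_pred n j \<notin> S"
  by (auto simp: doubled_def)

lemma inj_doubled: "inj (doubled n)"
proof (rule injI)
  fix S T assume "doubled n S = doubled n T"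
  then have "j \<in> S \<longleftrightarrow> j \<in> T" for j
    using Horiz_mem_doubled[of 0 j n S] Horiz_mem_doubled[of 0 j n T] by simp
  then show "S = T" by blast
qed

lemma mem_cycle_sets_pred:
  assumes "n \<ge> 2"
  shows "S \<in> cycle_sets n \<longleftrightarrow> S \<subseteq> {..<n} \<and> (\<forall>j\<in>S. cyclic_pred n j \<notin> S)"
proof -
  have pred_Suc: "cyclic_pred n (Suc i mod n) = i" if "i < n" for i
    using Suc_mod_eq_iff[of i n "Suc i mod n"] that by simp
  have Suc_pred: "Suc (cyclic_pred n j) mod n = j" if "j < n" for j
    using Suc_mod_eq_iff[of "cyclic_pred n j" n j] cyclic_pred_less[OF that] that by simp
  have "(\<forall>i\<in>S. Suc i mod n \<notin> S) \<longleftrightarrow> (\<forall>j\<in>S. cyclic_pred n j \<notin> S)" if "S \<subseteq> {..<n}"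
    using that pred_Suc Suc_pred by (metis lessThan_iff subsetD)
  then show ?thesis
    unfolding mem_cycle_sets[OF assms] by blast
qed

lemma doubled_perfect:
  assumes "n \<ge> 2" "S \<in> cycle_sets n"
  shows "is_perfect_matching (strip_ends n) (nodes n) (hex_edges n) (doubled n S)"
proof -
  have "doubled n S \<subseteq> hex_edges n"
    using cycle_setsD(1)[OF assms(2)] by (auto simp: doubled_def hex_edges_eq)
  moreover have "column_matched n (doubled n S) r j" if "r < 2" "j < n" for r j
    using assms that mem_cycle_sets_pred[OF assms(1), of S]
    by (auto simp: column_matched_def Horiz_mem_doubled Vert_mem_doubled)
  ultimately show ?thesis by (simp add: perfect_matching_hex_iff[OF assms(1)])
qed

section \<open>Weights of the matchings\<close>

text \<open>As \<open>n - 1\<close> is odd, \<open>(1, n - 1)\<close> is black and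
  \<open>(0, n - 1)\<close> is white.\<close>

lemma w_weight_hex:
  assumes "n \<ge> 2" "even n" "M \<subseteq> hex_edges n"
  shows "w_weight n M = of_bool (Horiz 1 (n - 1) \<in> M) - of_bool (Horiz 0 (n - 1) \<in> M)"
proof -
  have "{r. Horiz r (n - 1) \<in> M} = {r\<in>{0, 1}. Horiz r (n - 1) \<in> M}"
    using assms(3) by (auto simp: hex_edges_eq less_2_cases_iff)
  then have "w_weight n M =
      (\<Sum>r\<in>{0, 1}. if Horiz r (n - 1) \<in> M then colour_sign (r, n - 1) else 0)"
    unfolding w_weight_def by (simp only: sum.inter_filter finite.intros)
  then show ?thesis
    using assms(1,2) by (simp add: colour_sign_def black_def)
qed

lemma z_weight_doubled:
  assumes n: "n \<ge> 2" "even n" and S: "S \<in> cycle_sets n"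
  shows "z_weight (doubled n S) = int (n div 2) - int (card S)"
proof -
  \<comment> \<open>\<open>f j\<close> is the odd end of the cycle edge \<open>j\<close>. As
    \<open>n\<close> is even, an even \<open>j < n\<close> has \<open>Suc j < n\<close>, so no
    reduction modulo \<open>n\<close> is required.\<close>
  define f where "f j = (if odd j then j else Suc j)" for j :: nat
  define odds where "odds = {j. j < n \<and> odd j}"
  have S': "\<And>j. j \<in> S \<Longrightarrow> j < n" "\<And>j. j \<in> S \<Longrightarrow> cyclic_pred n j \<notin> S"
    using S mem_cycle_sets_pred[OF n(1), of S] by auto
  have fin: "finite odds" by (simp add: odds_def)
  have inj: "inj_on f S"
  proof (rule inj_onI)
    fix i j assume ij: "i \<in> S" "j \<in> S" "f i = f j"
    then have "i \<noteq> Suc j" "j \<noteq> Suc i"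
      using S'(2)[of i] S'(2)[of j] by (auto simp: cyclic_pred_def)
    then show "i = j" using ij(3) by (auto simp: f_def split: if_splits)
  qed
  have sub: "f ` S \<subseteq> odds"
  proof
    fix k assume "k \<in> f ` S"
    then obtain j where "j \<in> S" "k = f j" by blast
    then show "k \<in> odds" using S'(1)[of j] n(2) by (auto simp: odds_def f_def) presburger
  qed
  have "odds = (\<lambda>i. 2 * i + 1) ` {..<n div 2}"
    using n(2) by (auto simp: odds_def elim!: oddE evenE) presburger
  then have cardO: "card odds = n div 2" by (simp add: card_image inj_on_def)
  have vert: "{j. Vert 1 j \<in> doubled n S} = odds - f ` S"
  proof (intro subset_antisym subsetI)
    fix j assume "j \<in> {j. Vert 1 j \<in> doubled n S}"
    then have j: "odd j" "j < n" "j \<notin> S" "cyclic_pred n j \<notin> S"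
      by (auto simp: Vert_mem_doubled odd_iff_mod_2_eq_one)
    have "j \<noteq> f i" if "i \<in> S" for i
      using that j by (auto simp: f_def cyclic_pred_def split: if_splits)
    then show "j \<in> odds - f ` S" using j by (auto simp: odds_def)
  next
    fix j assume "j \<in> odds - f ` S"
    then have j: "odd j" "j < n" "j \<notin> f ` S" by (auto simp: odds_def)
    \<comment> \<open>The two cycle edges at the odd column \<open>j\<close> are \<open>j\<close>
      and \<open>j - 1\<close>, and \<open>f\<close> sends both to \<open>j\<close>.\<close>
    then have "j = f j" "j = f (j - 1)" by (auto simp: f_def elim: oddE)
    then have "j \<notin> S" "j - 1 \<notin> S" using j(3) by (metis imageI)+
    moreover have "j \<noteq> 0" using j(1) by (auto intro: ccontr)
    ultimately show "j \<in> {j. Vert 1 j \<in> doubled n S}" using j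
      by (auto simp: Vert_mem_doubled cyclic_pred_def odd_iff_mod_2_eq_one)
  qed
  have "z_weight (doubled n S) = (\<Sum>j\<in>odds - f ` S. 1)"
    unfolding z_weight_def vert
    by (rule sum.cong) (auto simp: odds_def colour_sign_def black_def)
  also have "\<dots> = int (card odds - card S)"
    using sub inj cycle_setsD(2)[OF S] by (simp add: card_Diff_subset card_image)
  \<comment> \<open>The natural subtraction does not truncate, because \<open>f\<close> embeds
    \<open>S\<close> into \<open>odds\<close>.\<close>
  also have "\<dots> = int (n div 2) - int (card S)"
    using card_mono[OF fin sub] by (simp add: cardO card_image[OF inj])
  finally show ?thesis .
qed

text \<open>Zero weight makes the rows agree on the edges crossing \<open>w\<close>. Agreement
  passes from each column to the next: the vertical edge is shared, and with it the entering edge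
  decides the leaving one.\<close>

lemma perfect_matching_zero_w_weight:
  assumes n: "n \<ge> 2" "even n"
    and M: "is_perfect_matching (strip_ends n) (nodes n) (hex_edges n) M"
    and w: "w_weight n M = 0"
  shows "\<exists>S\<in>cycle_sets n. M = doubled n S"
proof -
  have sub: "M \<subseteq> hex_edges n"
    and col: "\<And>r j. r < 2 \<Longrightarrow> j < n \<Longrightarrow> column_matched n M r j"
    using M perfect_matching_hex_iff[OF n(1)] by auto
  have last: "Horiz 1 (n - 1) \<in> M \<longleftrightarrow> Horiz 0 (n - 1) \<in> M"
    using w w_weight_hex[OF n sub] by (auto simp: of_bool_def split: if_splits)
  have step: "Horiz 1 j \<in> M \<longleftrightarrow> Horiz 0 j \<in> M"
    if "j < n" "Horiz 1 (cyclic_pred n j) \<in> M \<longleftrightarrow> Horiz 0 (cyclic_pred n j) \<in> M" for j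
    using that col[of 0 j] col[of 1 j] by (auto simp: column_matched_def split: if_splits)
  have rows: "Horiz 1 j \<in> M \<longleftrightarrow> Horiz 0 j \<in> M" if "j < n" for j
    using that
  proof (induction j)
    case 0
    then show ?case using step[of 0] last by (simp add: cyclic_pred_def)
  next
    case (Suc j)
    then show ?case using step[of "Suc j"] by (simp add: cyclic_pred_def)
  qed
  define S where "S = {j. Horiz 0 j \<in> M}"
  have lt: "j < n" if "Horiz r j \<in> M" for r j using that sub by (auto simp: hex_edges_eq)
  have "cyclic_pred n j \<notin> S" if "j \<in> S" for j
    using that lt[of 0 j] col[of 0 j] by (auto simp: S_def column_matched_def split: if_splits)
  then have "S \<in> cycle_sets n"
    unfolding mem_cycle_sets_pred[OF n(1)] using lt by (auto simp: S_def)
  moreover have "e \<in> M \<longleftrightarrow> e \<in> doubled n S" for e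
  proof (cases e)
    case (Horiz r j)
    have "Horiz r j \<in> M \<Longrightarrow> r < 2" using sub by (auto simp: hex_edges_eq)
    then show ?thesis using Horiz rows[of j] lt
      by (auto simp: Horiz_mem_doubled S_def less_2_cases_iff)
  next
    case (Vert r j)
    have "Vert r j \<in> M \<Longrightarrow> r = j mod 2 \<and> j < n" using sub by (auto simp: hex_edges_eq)
    then show ?thesis using Vert col[of 0 j]
      by (auto simp: Vert_mem_doubled S_def column_matched_def split: if_splits)
  qed
  ultimately show ?thesis by blast
qed

section \<open>The partition function\<close>

text \<open>\<open>doubled n\<close> is a bijection from cycle matchings to perfect matchings with
  \<open>n_w = 0\<close>, and \<open>z_weight_doubled\<close> translates the weight.\<close>

lemma num_perfect_hex:
  assumes n: "n \<ge> 2" "even n"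
  shows "num_perfect (hex_edges n) n k 0 =
    card {S \<in> cycle_sets n. int (n div 2) - int (card S) = k}"
proof -
  have w: "w_weight n (doubled n S) = 0" if "S \<in> cycle_sets n" for S
  proof -
    have "doubled n S \<subseteq> hex_edges n"
      using doubled_perfect[OF n(1) that] by (simp add: is_perfect_matching_def)
    then show ?thesis using w_weight_hex[OF n] by (simp add: Horiz_mem_doubled)
  qed
  have "{M. is_perfect_matching (strip_ends n) (nodes n) (hex_edges n) M \<and>
        z_weight M = k \<and> w_weight n M = 0} =
      doubled n ` {S \<in> cycle_sets n. int (n div 2) - int (card S) = k}"
  proof (intro subset_antisym subsetI)
    fix M assume M: "M \<in> {M. is_perfect_matching (strip_ends n) (nodes n) (hex_edges n) M \<and>
        z_weight M = k \<and> w_weight n M = 0}"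
    then obtain S where "S \<in> cycle_sets n" "M = doubled n S"
      using perfect_matching_zero_w_weight[OF n] by blast
    then show "M \<in> doubled n ` {S \<in> cycle_sets n. int (n div 2) - int (card S) = k}"
      using M z_weight_doubled[OF n] by auto
  qed (use w z_weight_doubled[OF n] doubled_perfect[OF n(1)] in auto)
  then show ?thesis
    unfolding num_perfect_def
    by (simp add: card_image inj_on_subset[OF inj_doubled])
qed

text \<open>At \<open>l = 0\<close> and \<open>k = n/2 - p\<close> the sign rule gives
  \<open>(-1)^(n/2) (-1)^p\<close>; the first factor does not depend on \<open>p\<close> and comes
  out of the sum.\<close>

lemma P_hex_eq:
  assumes n: "n \<ge> 2" "even n" and "z \<noteq> 0"
  shows "P_hex n z = (- 1) ^ (n div 2) *
    (z ^ (n div 2) * (\<Sum>p = 0..n. (- 1) ^ p * z powi (- int p) * of_nat (cycle_matchings n p)))"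
proof -
  let ?c = "\<lambda>k. newton_coeff (hex_edges n) n k 0"
  let ?h = "\<lambda>p. int (n div 2) - int p"
  \<comment> \<open>A nonzero coefficient needs a cycle matching, whose size is at most
    \<open>n\<close>; extending the sum to all \<open>p <= n\<close> only adds zeros.\<close>
  have "{k. ?c k \<noteq> 0} \<subseteq> ?h ` {0..n}"
  proof
    fix k assume "k \<in> {k. ?c k \<noteq> 0}"
    then have "num_perfect (hex_edges n) n k 0 \<noteq> 0" by (auto simp: newton_coeff_def)
    then have "{S \<in> cycle_sets n. ?h (card S) = k} \<noteq> {}"
      unfolding num_perfect_hex[OF n] by (metis card.empty)
    then obtain S where "S \<in> cycle_sets n" "?h (card S) = k" by blast
    then show "k \<in> ?h ` {0..n}" using cycle_setsD(3) by fastforce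
  qed
  then have "P_hex n z = (\<Sum>k\<in>?h ` {0..n}. ?c k * z powi k)"
    unfolding partition_z_def by (intro sum.mono_neutral_left) auto
  also have "\<dots> = (\<Sum>p = 0..n. ?c (?h p) * z powi ?h p)"
    by (subst sum.reindex) (auto simp: inj_on_def)
  also have "\<dots> = (\<Sum>p = 0..n. (- 1) ^ (n div 2) *
      (z ^ (n div 2) * ((- 1) ^ p * z powi (- int p) * of_nat (cycle_matchings n p))))"
  proof (rule sum.cong)
    fix p
    have "num_perfect (hex_edges n) n (?h p) 0 = cycle_matchings n p"
      unfolding num_perfect_hex[OF n] cycle_matchings_eq by simp
    moreover have "(- 1 :: complex) powi ?h p = (- 1) ^ (n div 2) * (- 1) ^ p"
      by (simp add: power_int_diff divide_simps flip: power_mult_distrib)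
    moreover have "z powi ?h p = z ^ (n div 2) * z powi (- int p)"
      using \<open>z \<noteq> 0\<close> by (simp add: power_int_diff power_int_minus divide_simps)
    ultimately show "?c (?h p) * z powi ?h p = (- 1) ^ (n div 2) *
      (z ^ (n div 2) * ((- 1) ^ p * z powi (- int p) * of_nat (cycle_matchings n p)))"
      by (simp add: newton_coeff_def)
  qed simp
  finally show ?thesis by (simp add: sum_distrib_left)
qed

theorem mainTheorem2:
  fixes n :: nat and z :: complex
  assumes "n \<ge> 2" and "even n" and "z \<noteq> 0"
  shows "(\<forall>p. real (cycle_matchings n p) =
           (if 2 * p \<le> n then real n / real (n - p) * real ((n - p) choose p) else 0)) \<and>
         P_hex n z = (- 1) ^ (n div 2) *
           (z ^ (n div 2) *
             (\<Sum>p = 0..n. (- 1) ^ p * z powi (- int p) * of_nat (cycle_matchings n p))) \<and>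
         z ^ (n div 2) *
           (\<Sum>p = 0..n. (- 1) ^ p * z powi (- int p) * of_nat (cycle_matchings n p)) =
         z ^ (n div 2) * monomer_dimer n (- 1 / z) \<and>
         z ^ (n div 2) * monomer_dimer n (- 1 / z) =
         z ^ (n div 2) / 2 ^ n *
           ((1 - csqrt (1 - 4 / z)) ^ n + (1 + csqrt (1 - 4 / z)) ^ n)"
proof (intro conjI)
  show "\<forall>p. real (cycle_matchings n p) =
      (if 2 * p \<le> n then real n / real (n - p) * real ((n - p) choose p) else 0)"
    using cycle_matchings_formula[OF assms(1)] by blast
  show "P_hex n z = (- 1) ^ (n div 2) *
      (z ^ (n div 2) * (\<Sum>p = 0..n. (- 1) ^ p * z powi (- int p) * of_nat (cycle_matchings n p)))"
    by (rule P_hex_eq[OF assms])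
  have "(- 1) ^ p * z powi (- int p) = (- 1 / z) ^ p" for p
    by (simp add: power_int_minus divide_inverse power_minus[of "inverse z"] power_inverse)
  then show "z ^ (n div 2) *
      (\<Sum>p = 0..n. (- 1) ^ p * z powi (- int p) * of_nat (cycle_matchings n p)) =
      z ^ (n div 2) * monomer_dimer n (- 1 / z)"
    by (simp add: monomer_dimer_def mult.commute)
  \<comment> \<open>The numbers \<open>(1 - s) / 2\<close> and \<open>(1 + s) / 2\<close> have sum
    \<open>1\<close> and product \<open>1 / z\<close>, hence are the roots of
    \<open>t^2 = t - 1 / z\<close>.\<close>
  define s where "s = csqrt (1 - 4 / z)"
  have s: "s\<^sup>2 = 1 - 4 / z" by (simp add: s_def)
  have "monomer_dimer n (- 1 / z) = ((1 - s) / 2) ^ n + ((1 + s) / 2) ^ n"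
  proof (rule monomer_dimer_power_sum[OF assms(1)])
    show "(1 - s) / 2 + (1 + s) / 2 = 1" by (simp add: field_simps)
    have "(1 - s) / 2 * ((1 + s) / 2) = (1 - s\<^sup>2) / 4"
      by (simp add: power2_eq_square algebra_simps)
    then show "- 1 / z = - ((1 - s) / 2 * ((1 + s) / 2))" by (simp add: s)
  qed
  then have "monomer_dimer n (- 1 / z) = ((1 - s) ^ n + (1 + s) ^ n) / 2 ^ n"
    by (simp only: power_divide flip: add_divide_distrib)
  then show "z ^ (n div 2) * monomer_dimer n (- 1 / z) =
      z ^ (n div 2) / 2 ^ n * ((1 - csqrt (1 - 4 / z)) ^ n + (1 + csqrt (1 - 4 / z)) ^ n)"
    by (simp add: s_def)
qed

end
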